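(* Let $R^d(l)$ be a $d$-dimensional rectangle with side lengths $l=(l_1,\ldots,l_d)$. Then $G^1_{\mathbb{R}^d}[R^d(l)]$ is connected if and only if $|l|\geq 2$. Moreover, if $|l|=2$ and $l'_1=\sqrt{\sum_{i\in I}l_i^2}$ and $l'_2=\sqrt{\sum_{i\notin I}l_i^2}$ for some $\emptyset\neq I\subsetneq \{1,\ldots,d\}$, then the graph diameter is bounded by $$\operatorname{diam}\left(G^1_{\mathbb{R}^d}[R^d(l)]\right)\leq \operatorname{diam}\left(G^1_{\mathbb{R}^2}[R^2(l'_1,l'_2)]\right)+2.$$
   Context: For $n\in\mathbb{N}$ and $X\subseteq\mathbb{R}^n$, $G^1_{\mathbb{R}^n}[X]$ is the graph with vertex set $X$ in which $x,y\in X$ are joined by an edge exactly when their Euclidean distance is $1$. The graph distance between two vertices is the minimum number of edges in a path between them, and $\operatorname{diam}$ of a graph is the maximal graph distance between any pair of its vertices. For a tuple $l=(l_1,\ldots,l_n)$ of non-negative real numbers, $R^n(l)=\{x\in\mathbb{R}^n: x_i\in[0,l_i]\text{ for all } i\}$ is the $n$-dimensional (hyper)rectangle with side lengths $l$, and $|l|=\sqrt{l_1^2+\cdots+l_n^2}$ is the Euclidean norm.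
   Formalization: The equivalence is proved when at least two side lengths are positive; with exactly one positive side only "connected implies |l| ≥ 2" is claimed, and l = 0 is excluded, since the equivalence fails for l = 0 and for a single positive side of length at least 2. *)

theory Defs
  imports "HOL-Analysis.Analysis" "HOL-Library.Extended_Nat" "Graph_Theory.Graph_Theory"
begin

text \<open>
  The unit-distance graph on a vertex set \<open>X\<close>. As usual in \<open>Graph_Theory\<close>, an
  undirected edge is represented by the two arcs \<open>(x, y)\<close> and \<open>(y, x)\<close>.
\<close>

definition unit_distance_graph ::
    "(real ^ 'n) set \<Rightarrow> (real ^ 'n, (real ^ 'n) \<times> (real ^ 'n)) pre_digraph" where
  "unit_distance_graph X =
     with_proj \<lparr> pverts = X, parcs = {(x, y). x \<in> X \<and> y \<in> X \<and> dist x y = 1} \<rparr>"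

lemma unit_distance_graph_simps [simp]:
  "verts (unit_distance_graph X) = X"
  "arcs (unit_distance_graph X) = {(x, y). x \<in> X \<and> y \<in> X \<and> dist x y = 1}"
  "tail (unit_distance_graph X) = fst"
  "head (unit_distance_graph X) = snd"
  by (simp_all add: unit_distance_graph_def)

lemma sym_digraph_unit_distance_graph: "sym_digraph (unit_distance_graph X)"
  by unfold_locales (auto simp: symmetric_conv dist_commute)

lemma loopfree_unit_distance_graph: "loopfree_digraph (unit_distance_graph X)"
  by unfold_locales auto

text \<open>
  Distance and diameter are extended natural numbers: the distance is \<open>\<infinity>\<close> if there
  is no path, and the diameter is \<open>\<infinity>\<close> if the distances are unbounded (in particular,
  if the graph is disconnected). A bounded supremum in \<^typ>\<open>enat\<close> is attained.
\<close>

definition graph_dist :: "('a, 'b) pre_digraph \<Rightarrow> 'a \<Rightarrow> 'a \<Rightarrow> enat" where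
  "graph_dist G u v = (INF p \<in> {p. pre_digraph.apath G u p v}. enat (length p))"

definition graph_diam :: "('a, 'b) pre_digraph \<Rightarrow> enat" where
  "graph_diam G = (SUP u \<in> verts G. SUP v \<in> verts G. graph_dist G u v)"

definition hyperrectangle :: "real ^ 'n \<Rightarrow> (real ^ 'n) set" where
  "hyperrectangle l = {x. \<forall>i. x $ i \<in> {0..l $ i}}"

end

theory Submission
  imports Defs
begin

text \<open>
  If \<open>\<bar>l\<bar> < 2\<close>, all points of the box are closer than \<open>1\<close> to its centre, which is thus isolated.

  If \<open>\<bar>l\<bar> = 2\<close>, every point has a neighbour on the main diagonal. The diagonal lies in an isometric
  copy of the planar rectangle \<open>R\<^sup>2(l'\<^sub>1, l'\<^sub>2)\<close>, whence the diameter bound. In the rectangle, a point of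
  a diagonal at signed distance \<open>t\<close> from the centre is linked in two steps, through the other diagonal,
  to one strictly closer to the centre; iterating, and treating points near the centre directly,
  the whole diagonal is linked to the centre.

  If \<open>\<bar>l\<bar> > 2\<close>, a similar box of diagonal \<open>2\<close> is slid through the given box.
\<close>

section \<open>Unit-distance steps\<close>

definition unit_edges :: "'a::metric_space set \<Rightarrow> 'a rel" where
  "unit_edges X = {(x, y). x \<in> X \<and> y \<in> X \<and> dist x y = 1}"

lemma sym_unit_edges: "sym (unit_edges X)"
  by (auto simp: unit_edges_def sym_def dist_commute)

lemma unit_edges_rtrancl_sym:
  "(x, y) \<in> (unit_edges X)\<^sup>* \<Longrightarrow> (y, x) \<in> (unit_edges X)\<^sup>*"
  using sym_rtrancl[OF sym_unit_edges] by (rule symD)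

text \<open>Serves for reflections, translations and \<open>section_embedding\<close>. The last need
  not be isometric off its rectangle when a side vanishes, so distances are compared on
  \<open>X\<close> only.\<close>

lemma unit_edges_rtrancl_image:
  assumes "(x, y) \<in> (unit_edges X)\<^sup>*"
    and "\<And>x. x \<in> X \<Longrightarrow> f x \<in> Y"
    and "\<And>x y. x \<in> X \<Longrightarrow> y \<in> X \<Longrightarrow> dist (f x) (f y) = dist x y"
  shows "(f x, f y) \<in> (unit_edges Y)\<^sup>*"
  using assms(1)
proof (induction rule: rtrancl_induct)
  case base
  show ?case by simp
next
  case (step y z)
  have "(f y, f z) \<in> unit_edges Y"
    using step.hyps(2) assms(2,3) by (auto simp: unit_edges_def)
  with step.IH show ?case by (rule rtrancl_into_rtrancl)
qed

lemma unit_edges_relpow_image: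
  assumes "(x, y) \<in> unit_edges X ^^ n"
    and "\<And>x. x \<in> X \<Longrightarrow> f x \<in> Y"
    and "\<And>x y. x \<in> X \<Longrightarrow> y \<in> X \<Longrightarrow> dist (f x) (f y) = dist x y"
  shows "(f x, f y) \<in> unit_edges Y ^^ n"
  using assms(1)
proof (induction n arbitrary: y)
  case 0
  then show ?case by simp
next
  case (Suc n)
  then obtain z where z: "(x, z) \<in> unit_edges X ^^ n" "(z, y) \<in> unit_edges X"
    by auto
  have "(f z, f y) \<in> unit_edges Y"
    using z(2) assms(2,3) by (auto simp: unit_edges_def)
  with Suc.IH[OF z(1)] show ?case by (rule relpow_Suc_I)
qed

section \<open>Walks, graph distance and connectedness\<close>

text \<open>Removing cycles only deletes arcs. \<open>graph_dist\<close> ranges over paths, while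
  powers of \<open>unit_edges\<close> describe walks.\<close>

lemma (in wf_digraph) length_awalk_to_apath_le:
  assumes "awalk u p v"
  shows "length (awalk_to_apath p) \<le> length p"
  using assms
proof (induct rule: awalk_to_apath_induct)
  case (path p)
  then have "awalk_to_apath p = p"
    by (auto simp: awalk_to_apath.simps)
  then show ?case by simp
next
  case (decomp p q r s)
  then have "p = q @ r @ s"
    by (auto elim: awalk_cyc_decompE)
  with decomp show ?case using step_awalk_to_apath[of u p v q r s] by simp
qed

text \<open>Induction on the first arc. For \<open>n = 0\<close> membership in \<open>X\<close>
  matters: the empty walk must sit at a vertex, whereas the zeroth power is the full
  identity.\<close>

lemma unit_edges_relpow_iff_awalk:
  fixes X :: "(real ^ 'n) set"
  assumes "x \<in> X"
  shows "(x, y) \<in> unit_edges X ^^ n \<longleftrightarrow>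
    (\<exists>p. pre_digraph.awalk (unit_distance_graph X) x p y \<and> length p = n)"
  using assms
proof (induction n arbitrary: x)
  case 0
  interpret sym_digraph "unit_distance_graph X" by (rule sym_digraph_unit_distance_graph)
  show ?case using 0 by (auto simp: awalk_Nil_iff)
next
  case (Suc n)
  interpret sym_digraph "unit_distance_graph X" by (rule sym_digraph_unit_distance_graph)
  have "(x, y) \<in> unit_edges X ^^ Suc n \<longleftrightarrow>
      (\<exists>z. (x, z) \<in> unit_edges X \<and> (z, y) \<in> unit_edges X ^^ n)"
    by (metis relpow_Suc_D2 relpow_Suc_I2)
  also have "\<dots> \<longleftrightarrow> (\<exists>z. (x, z) \<in> unit_edges X \<and> (\<exists>p. awalk z p y \<and> length p = n))"
    using Suc.IH by (auto simp: unit_edges_def)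
  also have "\<dots> \<longleftrightarrow> (\<exists>p. awalk x p y \<and> length p = Suc n)"
    (is "?L \<longleftrightarrow> ?R")
  proof
    assume ?L
    then obtain z p where "(x, z) \<in> unit_edges X" "awalk z p y" "length p = n" by blast
    then show ?R
      by (intro exI[of _ "(x, z) # p"]) (auto simp: awalk_Cons_iff unit_edges_def)
  next
    assume ?R
    then show ?L
      by (fastforce simp: length_Suc_conv awalk_Cons_iff unit_edges_def)
  qed
  finally show ?case .
qed

lemma graph_dist_le:
  fixes X :: "(real ^ 'n) set"
  assumes "x \<in> X" "(x, y) \<in> unit_edges X ^^ n"
  shows "graph_dist (unit_distance_graph X) x y \<le> enat n"
proof -
  interpret sym_digraph "unit_distance_graph X" by (rule sym_digraph_unit_distance_graph)
  obtain p where p: "awalk x p y" "length p = n"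
    using unit_edges_relpow_iff_awalk assms by blast
  have "graph_dist (unit_distance_graph X) x y \<le> enat (length (awalk_to_apath p))"
    unfolding graph_dist_def using apath_awalk_to_apath[OF p(1)] by (auto intro: INF_lower)
  also have "\<dots> \<le> enat n"
    using length_awalk_to_apath_le[OF p(1)] p(2) by simp
  finally show ?thesis .
qed

text \<open>A finite infimum in \<open>enat\<close> is taken over a non-empty set and is therefore
  attained.\<close>

lemma graph_dist_attained:
  fixes X :: "(real ^ 'n) set"
  assumes "x \<in> X" "graph_dist (unit_distance_graph X) x y = enat n"
  shows "(x, y) \<in> unit_edges X ^^ n"
proof -
  interpret sym_digraph "unit_distance_graph X" by (rule sym_digraph_unit_distance_graph)
  let ?L = "(\<lambda>p. enat (length p)) ` {p. apath x p y}"
  have Inf_L: "Inf ?L = enat n"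
    using assms(2) by (simp add: graph_dist_def)
  have "?L \<noteq> {}"
  proof
    assume "?L = {}"
    then have "Inf ?L = \<infinity>"
      by (simp only: Inf_empty top_enat_def)
    then show False using Inf_L by simp
  qed
  then have "Inf ?L \<in> ?L"
    unfolding Inf_enat_def using LeastI_ex[of "\<lambda>e. e \<in> ?L"] by auto
  then obtain p where "apath x p y" "length p = n"
    unfolding Inf_L by auto
  then show ?thesis
    using unit_edges_relpow_iff_awalk[OF assms(1)] awalkI_apath by blast
qed

text \<open>\<open>connected\<close> refers to the symmetric closure of the arcs; these are
  symmetric already, so reachability is unchanged.\<close>

lemma connected_unit_distance_graph_iff:
  fixes X :: "(real ^ 'n) set"
  shows "Digraph_Component.connected (unit_distance_graph X) \<longleftrightarrow>
    X \<noteq> {} \<and> (\<forall>x\<in>X. \<forall>y\<in>X. (x, y) \<in> (unit_edges X)\<^sup>*)"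
proof -
  interpret sym_digraph "unit_distance_graph X" by (rule sym_digraph_unit_distance_graph)
  have "x \<rightarrow>\<^sup>*\<^bsub>unit_distance_graph X\<^esub> y \<longleftrightarrow> (x, y) \<in> (unit_edges X)\<^sup>*" if "x \<in> X" for x y
    unfolding reachable_awalk rtrancl_is_UN_relpow using unit_edges_relpow_iff_awalk[OF that] by auto
  then show ?thesis
    by (simp add: Digraph_Component.connected_def strongly_connected_def
        reachable_mk_symmetric_eq[OF sym_arcs])
qed

section \<open>Boxes\<close>

lemma dist_centre_le:
  fixes l y :: "real ^ 'n"
  assumes "y \<in> hyperrectangle l"
  shows "dist (l /\<^sub>R 2) y \<le> norm l / 2"
proof -
  have "norm (l /\<^sub>R 2 - y) \<le> norm (l /\<^sub>R 2)"
  proof (rule norm_le_componentwise_cart)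
    fix i
    have "0 \<le> y $ i" "y $ i \<le> l $ i"
      using assms by (auto simp: hyperrectangle_def)
    then show "norm ((l /\<^sub>R 2 - y) $ i) \<le> norm ((l /\<^sub>R 2) $ i)"
      by (simp add: abs_if)
  qed
  then show ?thesis by (simp add: dist_norm)
qed

lemma connected_imp_norm_ge_2:
  fixes l :: "real ^ 'n"
  assumes nonneg: "\<And>i. 0 \<le> l $ i" and pos: "0 < l $ i"
    and conn: "Digraph_Component.connected (unit_distance_graph (hyperrectangle l))"
  shows "2 \<le> norm l"
proof (rule ccontr)
  assume "\<not> 2 \<le> norm l"
  let ?X = "hyperrectangle l"
  have "0 \<in> ?X" "l /\<^sub>R 2 \<in> ?X"
    using nonneg by (auto simp: hyperrectangle_def)
  then have "(l /\<^sub>R 2, 0) \<in> (unit_edges ?X)\<^sup>*"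
    using conn by (simp add: connected_unit_distance_graph_iff)
  then show False
  proof (cases rule: converse_rtranclE)
    \<comment> \<open>A positive side separates the centre from the vertex \<open>0\<close>, so the
      walk must really leave the centre.\<close>
    case base
    then show False using pos by auto
  next
    case (step y)
    then show False
      using dist_centre_le[of y l] \<open>\<not> 2 \<le> norm l\<close> by (auto simp: unit_edges_def)
  qed
qed

lemma diagonal_in_box:
  fixes l :: "real ^ 'n"
  assumes "\<And>i. 0 \<le> l $ i" "0 \<le> s" "s \<le> 1"
  shows "s *\<^sub>R l \<in> hyperrectangle l"
  using assms by (auto simp: hyperrectangle_def mult_left_le_one_le)

text \<open>Apollonius: \<open>\<bar>x\<bar>\<^sup>2 + \<bar>x - l\<bar>\<^sup>2 = 2 \<bar>x - l/2\<bar>\<^sup>2 + 2\<close>, so one end of the diagonal has distance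
  at least \<open>1\<close> from \<open>x\<close>, while its midpoint has distance at most \<open>1\<close>.\<close>

lemma ex_diagonal_neighbour:
  fixes l x :: "real ^ 'n"
  assumes nonneg: "\<And>i. 0 \<le> l $ i" and "norm l = 2" and x: "x \<in> hyperrectangle l"
  shows "\<exists>s\<in>{0..1}. (x, s *\<^sub>R l) \<in> unit_edges (hyperrectangle l)"
proof -
  have cont: "continuous_on S (\<lambda>s. dist x (s *\<^sub>R l))" for S
    by (intro continuous_intros)
  have mid: "dist x ((1/2) *\<^sub>R l) \<le> 1"
    using dist_centre_le[OF x] assms(2) by (simp add: dist_commute)
  have l4: "l \<bullet> l = 4"
    using assms(2) by (simp add: power2_norm_eq_inner[symmetric])
  have "(dist x (0 *\<^sub>R l))\<^sup>2 + (dist x (1 *\<^sub>R l))\<^sup>2 = 2 * (dist x ((1/2) *\<^sub>R l))\<^sup>2 + 2"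
    by (simp add: dist_norm power2_norm_eq_inner inner_diff_left inner_diff_right l4 inner_commute)
  then have "1 \<le> dist x (0 *\<^sub>R l) \<or> 1 \<le> dist x (1 *\<^sub>R l)"
    using abs_square_less_1[of "dist x (0 *\<^sub>R l)"] abs_square_less_1[of "dist x (1 *\<^sub>R l)"]
    by (smt (verit) zero_le_dist zero_le_power2)
  then obtain s where s: "s \<in> {0..1}" "dist x (s *\<^sub>R l) = 1"
  proof
    assume "1 \<le> dist x (0 *\<^sub>R l)"
    then obtain s where "0 \<le> s" "s \<le> 1/2" "dist x (s *\<^sub>R l) = 1"
      using IVT2'[of "\<lambda>s. dist x (s *\<^sub>R l)" "1/2" 1 0] mid cont by auto
    then show ?thesis by (intro that[of s]) auto
  next
    assume "1 \<le> dist x (1 *\<^sub>R l)"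
    then obtain s where "1/2 \<le> s" "s \<le> 1" "dist x (s *\<^sub>R l) = 1"
      using IVT'[of "\<lambda>s. dist x (s *\<^sub>R l)" "1/2" 1 1] mid cont by auto
    then show ?thesis by (intro that[of s]) auto
  qed
  then show ?thesis
    using x diagonal_in_box[of l s] nonneg by (auto simp: unit_edges_def)
qed

section \<open>The planar section through the diagonal\<close>

definition section_sides :: "'n set \<Rightarrow> real ^ 'n \<Rightarrow> real ^ 2" where
  "section_sides I l =
    vector [sqrt (\<Sum>i\<in>I. (l $ i)\<^sup>2), sqrt (\<Sum>i\<in>- I. (l $ i)\<^sup>2)]"

text \<open>If a side of the section vanishes then so do the corresponding sides of the box, and
  the division by zero is harmless.\<close>

definition section_embedding :: "'n set \<Rightarrow> real ^ 'n \<Rightarrow> real ^ 2 \<Rightarrow> real ^ 'n" where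
  "section_embedding I l z = (\<chi> i.
    (if i \<in> I then z $ 1 / section_sides I l $ 1 else z $ 2 / section_sides I l $ 2) * l $ i)"

text \<open>The section has the same diagonal length as the box, so diagonal 2 is inherited.\<close>

lemma section_sides_sum:
  "(section_sides I l $ 1)\<^sup>2 + (section_sides I l $ 2)\<^sup>2 = (norm l)\<^sup>2"
proof -
  have "(\<Sum>i\<in>UNIV. (l $ i)\<^sup>2) = (\<Sum>i\<in>I. (l $ i)\<^sup>2) + (\<Sum>i\<in>-I. (l $ i)\<^sup>2)"
    using sum.union_disjoint[of I "- I" "\<lambda>i. (l $ i)\<^sup>2"] by simp
  then show ?thesis
    by (simp add: section_sides_def norm_vec_def L2_set_def sum_nonneg)
qed

lemma section_sides_eq_0:
  fixes I :: "('n::finite) set" and l :: "real ^ 'n"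
  assumes "section_sides I l $ 1 = 0" "i \<in> I"
  shows "l $ i = 0"
  using assms by (simp add: section_sides_def sum_nonneg_eq_0_iff)

lemma section_sides_eq_0':
  fixes I :: "('n::finite) set" and l :: "real ^ 'n"
  assumes "section_sides I l $ 2 = 0" "i \<notin> I"
  shows "l $ i = 0"
  using assms by (simp add: section_sides_def sum_nonneg_eq_0_iff)

lemma section_embedding_in_box:
  assumes nonneg: "\<And>i. 0 \<le> l $ i" and z: "z \<in> hyperrectangle (section_sides I l)"
  shows "section_embedding I l z \<in> hyperrectangle l"
proof -
  have *: "0 \<le> w / a \<and> w / a \<le> 1" if "0 \<le> w" "w \<le> a" for w a :: real
    using that by (cases "a = 0") (auto simp: divide_simps)
  have "0 \<le> z $ 1 / section_sides I l $ 1 \<and> z $ 1 / section_sides I l $ 1 \<le> 1"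
    "0 \<le> z $ 2 / section_sides I l $ 2 \<and> z $ 2 / section_sides I l $ 2 \<le> 1"
    using z by (auto simp: hyperrectangle_def intro!: *)
  then show ?thesis
    using nonneg by (auto simp: hyperrectangle_def section_embedding_def mult_left_le_one_le)
qed

text \<open>On each of the blocks \<open>I\<close> and \<open>- I\<close> the image is a multiple of
  \<open>l\<close>, and the squared length of \<open>l\<close> on the block cancels the squared side
  in the denominator.\<close>

lemma dist_section_embedding:
  assumes "z \<in> hyperrectangle (section_sides I l)" "w \<in> hyperrectangle (section_sides I l)"
  shows "dist (section_embedding I l z) (section_embedding I l w) = dist z w"
proof -
  define a b where "a = section_sides I l $ 1" and "b = section_sides I l $ 2"
  have a2: "(\<Sum>i\<in>I. (l $ i)\<^sup>2) = a\<^sup>2" and b2: "(\<Sum>i\<in>-I. (l $ i)\<^sup>2) = b\<^sup>2"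
    by (simp_all add: a_def b_def section_sides_def sum_nonneg)
  \<comment> \<open>For \<open>c = 0\<close> the bounds force \<open>x = y = 0\<close>, so the
    cancellation survives.\<close>
  have cancel: "((x / c - y / c) * c)\<^sup>2 = (x - y)\<^sup>2" if "0 \<le> x" "x \<le> c" "0 \<le> y" "y \<le> c" for x y c :: real
    using that by (cases "c = 0") (simp_all add: diff_divide_distrib[symmetric])
  have "(dist (section_embedding I l z) (section_embedding I l w))\<^sup>2 =
      (\<Sum>i\<in>UNIV. (section_embedding I l z $ i - section_embedding I l w $ i)\<^sup>2)"
    by (simp add: dist_vec_def L2_set_def dist_real_def sum_nonneg)
  also have "\<dots> = (\<Sum>i\<in>I. (section_embedding I l z $ i - section_embedding I l w $ i)\<^sup>2)
      + (\<Sum>i\<in>-I. (section_embedding I l z $ i - section_embedding I l w $ i)\<^sup>2)"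
    using sum.union_disjoint[of I "- I"] by simp
  also have "(\<Sum>i\<in>I. (section_embedding I l z $ i - section_embedding I l w $ i)\<^sup>2)
      = (\<Sum>i\<in>I. (z $ 1 / a - w $ 1 / a)\<^sup>2 * (l $ i)\<^sup>2)"
    by (intro sum.cong) (auto simp: section_embedding_def a_def power_mult_distrib[symmetric] left_diff_distrib)
  also have "\<dots> = (z $ 1 - w $ 1)\<^sup>2"
    unfolding sum_distrib_left[symmetric] a2 unfolding power_mult_distrib[symmetric]
    using assms by (intro cancel) (auto simp: hyperrectangle_def a_def)
  also have "(\<Sum>i\<in>-I. (section_embedding I l z $ i - section_embedding I l w $ i)\<^sup>2)
      = (\<Sum>i\<in>-I. (z $ 2 / b - w $ 2 / b)\<^sup>2 * (l $ i)\<^sup>2)"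
    by (intro sum.cong) (auto simp: section_embedding_def b_def power_mult_distrib[symmetric] left_diff_distrib)
  also have "\<dots> = (z $ 2 - w $ 2)\<^sup>2"
    unfolding sum_distrib_left[symmetric] b2 unfolding power_mult_distrib[symmetric]
    using assms by (intro cancel) (auto simp: hyperrectangle_def b_def)
  also have "(z $ 1 - w $ 1)\<^sup>2 + (z $ 2 - w $ 2)\<^sup>2 = (dist z w)\<^sup>2"
    by (simp add: dist_vec_def L2_set_def dist_real_def sum_2)
  finally show ?thesis by simp
qed

lemma section_embedding_diagonal:
  "section_embedding I l (s *\<^sub>R section_sides I l) = s *\<^sub>R l"
proof -
  have "section_embedding I l (s *\<^sub>R section_sides I l) $ i = s * l $ i" for i
    using section_sides_eq_0[where I = I and l = l and i = i]
      section_sides_eq_0'[where I = I and l = l and i = i]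
    by (cases "i \<in> I") (auto simp: section_embedding_def)
  then show ?thesis
    by (simp add: vec_eq_iff)
qed

text \<open>One step from \<open>x\<close> to the diagonal and one from the diagonal to
  \<open>y\<close> account for the \<open>+ 2\<close>; in between, a shortest walk of the rectangle
  is carried over with its length.\<close>

lemma graph_diam_le_section:
  fixes l :: "real ^ 'n"
  assumes nonneg: "\<And>i. 0 \<le> l $ i" and l2: "norm l = 2"
  shows "graph_diam (unit_distance_graph (hyperrectangle l)) \<le>
    graph_diam (unit_distance_graph (hyperrectangle (section_sides I l))) + 2"
proof -
  let ?X = "hyperrectangle l" and ?Y = "hyperrectangle (section_sides I l)"
  let ?D = "graph_diam (unit_distance_graph ?Y)"
  have "graph_dist (unit_distance_graph ?X) x y \<le> ?D + 2" if xy: "x \<in> ?X" "y \<in> ?X" for x y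
  proof (cases ?D)
    case infinity
    then show ?thesis by simp
  next
    case (enat N)
    obtain s where s: "s \<in> {0..1}" "(x, s *\<^sub>R l) \<in> unit_edges ?X"
      using ex_diagonal_neighbour[OF nonneg l2 xy(1)] by blast
    obtain t where t: "t \<in> {0..1}" "(y, t *\<^sub>R l) \<in> unit_edges ?X"
      using ex_diagonal_neighbour[OF nonneg l2 xy(2)] by blast
    let ?p = "s *\<^sub>R section_sides I l" and ?q = "t *\<^sub>R section_sides I l"
    have side: "0 \<le> section_sides I l $ i" for i
      using exhaust_2[of i] by (auto simp: section_sides_def intro!: sum_nonneg)
    have pq: "?p \<in> ?Y" "?q \<in> ?Y"
      using s(1) t(1) side by (auto intro!: diagonal_in_box)
    have "graph_dist (unit_distance_graph ?Y) ?p ?q \<le> ?D"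
      unfolding graph_diam_def using pq
      by (intro SUP_upper2[of ?p] SUP_upper2[of ?q]) auto
    with enat obtain n where n: "graph_dist (unit_distance_graph ?Y) ?p ?q = enat n" "n \<le> N"
      by (cases "graph_dist (unit_distance_graph ?Y) ?p ?q") auto
    have "(section_embedding I l ?p, section_embedding I l ?q) \<in> unit_edges ?X ^^ n"
      by (rule unit_edges_relpow_image[OF graph_dist_attained[OF pq(1) n(1)]
            section_embedding_in_box[OF nonneg] dist_section_embedding])
    then have "(s *\<^sub>R l, t *\<^sub>R l) \<in> unit_edges ?X ^^ n"
      unfolding section_embedding_diagonal .
    moreover have "(t *\<^sub>R l, y) \<in> unit_edges ?X"
      using t(2) sym_unit_edges by (auto dest: symD)
    ultimately have "(x, y) \<in> unit_edges ?X ^^ Suc (Suc n)"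
      using s(2) by (intro relpow_Suc_I2[of x "s *\<^sub>R l"] relpow_Suc_I[of _ "t *\<^sub>R l"])
    from graph_dist_le[OF xy(1) this] show ?thesis
      using n(2) enat by (auto simp: numeral_eq_enat elim: order_trans)
  qed
  then show ?thesis
    by (subst (1) graph_diam_def) (auto intro!: SUP_least)
qed


section \<open>Connectedness of the diagonal of a rectangle\<close>

lemma unit_edges_rectangle_iff:
  "(vector [x, y] :: real ^ 2, vector [x', y']) \<in> unit_edges (hyperrectangle (vector [a, b])) \<longleftrightarrow>
    x \<in> {0..a} \<and> y \<in> {0..b} \<and> x' \<in> {0..a} \<and> y' \<in> {0..b} \<and> (x - x')\<^sup>2 + (y - y')\<^sup>2 = 1"
  by (auto simp: unit_edges_def hyperrectangle_def forall_2 dist_vec_def L2_set_def sum_2 dist_real_def)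

text \<open>The centre is the common target because the reflections of the rectangle fix it.\<close>

definition reaches_centre :: "real \<Rightarrow> real \<Rightarrow> real \<Rightarrow> real \<Rightarrow> bool" where
  "reaches_centre a b x y \<longleftrightarrow>
    (vector [x, y] :: real ^ 2, vector [a / 2, b / 2]) \<in> (unit_edges (hyperrectangle (vector [a, b])))\<^sup>*"

lemma reaches_centre_step:
  assumes "reaches_centre a b x' y'"
    and "x \<in> {0..a}" "y \<in> {0..b}" "x' \<in> {0..a}" "y' \<in> {0..b}" "(x - x')\<^sup>2 + (y - y')\<^sup>2 = 1"
  shows "reaches_centre a b x y"
  using assms unfolding reaches_centre_def
  by (metis converse_rtrancl_into_rtrancl unit_edges_rectangle_iff)

text \<open>Reflection in the midline at height \<open>b / 2\<close>, which interchanges the two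
  diagonals.\<close>

lemma reaches_centre_reflect:
  assumes "reaches_centre a b x y"
  shows "reaches_centre a b x (b - y)"
proof -
  define f where "f z = (vector [z $ 1, b - z $ 2] :: real ^ 2)" for z :: "real ^ 2"
  have "(f (vector [x, y]), f (vector [a / 2, b / 2])) \<in> (unit_edges (hyperrectangle (vector [a, b])))\<^sup>*"
    by (rule unit_edges_rtrancl_image[OF assms[unfolded reaches_centre_def]])
      (auto simp: f_def hyperrectangle_def forall_2 dist_vec_def L2_set_def sum_2 dist_real_def power2_commute)
  then show ?thesis
    by (simp add: f_def reaches_centre_def)
qed

lemma reaches_centre_reflect':
  assumes "reaches_centre a b x y"
  shows "reaches_centre a b (a - x) y"
proof -
  define f where "f z = (vector [a - z $ 1, z $ 2] :: real ^ 2)" for z :: "real ^ 2"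
  have "(f (vector [x, y]), f (vector [a / 2, b / 2])) \<in> (unit_edges (hyperrectangle (vector [a, b])))\<^sup>*"
    by (rule unit_edges_rtrancl_image[OF assms[unfolded reaches_centre_def]])
      (auto simp: f_def hyperrectangle_def forall_2 dist_vec_def L2_set_def sum_2 dist_real_def power2_commute)
  then show ?thesis
    by (simp add: f_def reaches_centre_def)
qed

section \<open>Corners and the neighbourhood of the centre\<close>

text \<open>Corners lie half a diagonal, that is 1, away from the centre.\<close>

lemma corner_reaches_centre:
  assumes "0 < a" "0 < b" "a\<^sup>2 + b\<^sup>2 = (4::real)"
  shows "reaches_centre a b a 0" "reaches_centre a b a b"
proof -
  have centre: "reaches_centre a b (a / 2) (b / 2)"
    by (simp add: reaches_centre_def)
  have "(a - a / 2)\<^sup>2 + (0 - b / 2)\<^sup>2 = 1"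
    using assms(3) by (simp add: power2_eq_square field_simps)
  then show c: "reaches_centre a b a 0"
    by (rule reaches_centre_step[OF centre, rotated -1]) (use assms in auto)
  show "reaches_centre a b a b"
    using reaches_centre_reflect[OF c] by simp
qed

text \<open>A point \<open>p\<close> of the diagonal just beyond the centre is adjacent to a point \<open>(z, 0)\<close> close to
  the corner \<open>(0, 0)\<close>, and \<open>(z, 0)\<close> and \<open>(a, 0)\<close> have a common neighbour inside the rectangle.\<close>

lemma near_centre_reaches_centre:
  assumes "0 < a" "0 < b" "a\<^sup>2 + b\<^sup>2 = (4::real)"
  shows "eventually (\<lambda>t. reaches_centre a b ((1 + t) * a / 2) ((1 + t) * b / 2)) (at_right 0)"
proof -
  \<comment> \<open>\<open>y t\<close> is the height of \<open>p\<close>; for small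
    \<open>t\<close>, \<open>z t\<close> is the abscissa of the left one of the two points at
    distance 1 from \<open>p\<close> on the bottom line.\<close>
  define y where "y t = (1 + t) * b / 2" for t
  define z where "z t = (1 + t) * a / 2 - sqrt (1 - (y t)\<^sup>2)" for t
  have "a\<^sup>2 \<le> 4"
    using assms(3) zero_le_power2[of b] by linarith
  then have a2: "a \<le> 2"
    using power2_le_imp_le[of a 2] by simp
  have b2: "1 - (b / 2)\<^sup>2 = (a / 2)\<^sup>2"
    using assms(3) by (simp add: power2_eq_square field_simps)
  have y0: "y 0 = b / 2" by (simp add: y_def)
  have "sqrt (1 - (y 0)\<^sup>2) = a / 2"
    unfolding y0 b2 using assms(1) by simp
  then have z0: "z 0 = 0" by (simp add: z_def)
  have y_lim: "(y \<longlongrightarrow> y 0) (at_right 0)" and z_lim: "(z \<longlongrightarrow> z 0) (at_right 0)"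
    unfolding y_def z_def by (intro tendsto_intros; simp)+
  have y2_lim: "((\<lambda>t. (y t)\<^sup>2) \<longlongrightarrow> (y 0)\<^sup>2) (at_right 0)"
    by (intro tendsto_intros y_lim)
  have z2_lim: "((\<lambda>t. ((a - z t) / 2)\<^sup>2) \<longlongrightarrow> ((a - z 0) / 2)\<^sup>2) (at_right 0)"
    by (intro tendsto_intros z_lim) simp
  have "(y 0)\<^sup>2 < 1"
  proof -
    have "0 < (a / 2)\<^sup>2" using assms(1) by simp
    then show ?thesis unfolding y0 using b2 by linarith
  qed
  then have "eventually (\<lambda>t. (y t)\<^sup>2 < 1) (at_right 0)"
    by (rule order_tendstoD(2)[OF y2_lim])
  \<comment> \<open>At \<open>t = 0\<close> the squared height of the common neighbour is
    \<open>b^2 / 4 < b^2\<close>; strictness lets this persist for small \<open>t\<close>.\<close>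
  moreover have "1 - b\<^sup>2 < ((a - z 0) / 2)\<^sup>2"
  proof -
    have "(b / 2)\<^sup>2 < b\<^sup>2" using assms(2) by (simp add: power_divide)
    then show ?thesis unfolding z0 using b2 by simp
  qed
  then have "eventually (\<lambda>t. 1 - b\<^sup>2 < ((a - z t) / 2)\<^sup>2) (at_right 0)"
    by (rule order_tendstoD(1)[OF z2_lim])
  moreover have "eventually (\<lambda>t. t \<in> {0<..<1}) (at_right (0::real))"
    by (rule eventually_at_right_real) simp
  ultimately show ?thesis
  proof eventually_elim
    case (elim t)
    let ?x = "(1 + t) * a / 2"
    \<comment> \<open>The common neighbour is the apex of the isosceles triangle with legs 1 over
      the base from \<open>(z t, 0)\<close> to \<open>(a, 0)\<close>; this is its height.\<close>
    let ?w = "sqrt (1 - ((a - z t) / 2)\<^sup>2)"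
    have t: "0 < t" "t < 1" using elim by auto
    \<comment> \<open>The distance of \<open>p\<close> from the origin is \<open>1 + t\<close>, so
      \<open>z t\<close> is not negative.\<close>
    have "?x\<^sup>2 + (y t)\<^sup>2 = (1 + t)\<^sup>2 * ((a\<^sup>2 + b\<^sup>2) / 4)"
      by (simp add: y_def power2_eq_square field_simps)
    also have "\<dots> \<ge> 1" using t by (simp add: assms(3))
    finally have "sqrt (1 - (y t)\<^sup>2) \<le> ?x"
      using t assms by (intro real_le_lsqrt) auto
    then have z: "0 \<le> z t" by (simp add: z_def)
    have xa: "?x \<le> a" using t assms by (simp add: field_simps)
    have yb: "0 \<le> y t" "y t \<le> b" using t assms by (simp_all add: y_def field_simps)
    have zx: "z t \<le> ?x" using elim by (simp add: z_def)
    have za: "z t \<le> a" using zx xa by (rule order_trans)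
    have "((a - z t) / 2)\<^sup>2 \<le> 1"
      using z zx xa a2 by (simp add: power_le_one_iff abs_square_le_1)
    moreover have "?w \<le> b"
      using elim assms by (intro real_le_lsqrt) auto
    moreover have "0 \<le> ?w" using calculation by simp
    moreover have "(a + z t) / 2 \<in> {0..a}"
      using z za by auto
    moreover have "((a + z t) / 2 - a)\<^sup>2 = ((a - z t) / 2)\<^sup>2" "(z t - (a + z t) / 2)\<^sup>2 = ((a - z t) / 2)\<^sup>2"
      by (simp_all add: power2_eq_square field_simps)
    ultimately have "((a + z t) / 2 - a)\<^sup>2 + (?w - 0)\<^sup>2 = 1"
      and w: "(z t - (a + z t) / 2)\<^sup>2 + (0 - ?w)\<^sup>2 = 1" "(a + z t) / 2 \<in> {0..a}" "?w \<in> {0..b}"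
      by auto
    then have "reaches_centre a b ((a + z t) / 2) ?w"
      using assms by (intro reaches_centre_step[OF corner_reaches_centre(1)[OF assms]]) auto
    then have "reaches_centre a b (z t) 0"
      by (rule reaches_centre_step) (use w assms z za in auto)
    moreover have "(?x - z t)\<^sup>2 + (y t - 0)\<^sup>2 = 1"
      using elim by (simp add: z_def)
    moreover have "?x \<in> {0..a}" "y t \<in> {0..b}" "z t \<in> {0..a}" "0 \<in> {0..b}"
      using assms t z za xa yb by auto
    ultimately have "reaches_centre a b ?x (y t)"
      using reaches_centre_step by blast
    then show ?case by (simp add: y_def)
  qed
qed

section \<open>Descent along the diagonals\<close>

text \<open>Write points of the two diagonals as the centre plus \<open>t\<close> times the unit vectors
  \<open>(a/2, b/2)\<close> and \<open>(a/2, -b/2)\<close>, whose inner product is \<open>k\<close>. The point \<open>t\<close> of the first diagonal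
  is adjacent to the point \<open>descent k t - 1\<close> of the second, which is adjacent to \<open>descent k t\<close> there.\<close>

definition descent :: "real \<Rightarrow> real \<Rightarrow> real" where
  "descent k t = 1 + t * k - sqrt (1 - t\<^sup>2 * (1 - k\<^sup>2))"

text \<open>The root is at most 1, which gives the first bound. For the second,
  \<open>1 - t * (1 - k)\<close> is compared with the root: the squares differ by a product of
  positive factors.\<close>

lemma descent_bounds:
  assumes "0 \<le> k" "k < 1" "0 < t" "t < 1"
  shows "0 \<le> descent k t" "descent k t < t"
proof -
  have k2: "k\<^sup>2 < 1" using assms by (simp add: abs_square_less_1)
  have "sqrt (1 - t\<^sup>2 * (1 - k\<^sup>2)) \<le> 1"
    using k2 by (intro real_le_lsqrt) auto
  moreover have "0 \<le> t * k" using assms by simp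
  ultimately show "0 \<le> descent k t"
    unfolding descent_def by linarith
  have "t * (1 - k) < 1"
    using assms mult_left_le[of "1 - k" t] by linarith
  moreover have "(1 - t * (1 - k))\<^sup>2 < 1 - t\<^sup>2 * (1 - k\<^sup>2)"
  proof -
    have "1 - t\<^sup>2 * (1 - k\<^sup>2) - (1 - t * (1 - k))\<^sup>2 = 2 * (1 - k) * (t * (1 - t))"
      by (simp add: power2_eq_square algebra_simps)
    moreover have "0 < 2 * (1 - k) * (t * (1 - t))" using assms by simp
    ultimately show ?thesis by linarith
  qed
  ultimately have "1 - t * (1 - k) < sqrt (1 - t\<^sup>2 * (1 - k\<^sup>2))"
    by (intro real_less_rsqrt) 
  then show "descent k t < t"
    by (simp add: descent_def algebra_simps)
qed

text \<open>The two steps are built backwards: a reflection moves the point \<open>g\<close> to the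
  second diagonal, a unit step along it leads to \<open>g - 1\<close>, and a unit step across leads
  to \<open>t\<close>.\<close>

lemma reaches_centre_descent:
  assumes ab: "0 < b" "b \<le> a" "a\<^sup>2 + b\<^sup>2 = (4::real)" and t: "0 < t" "t < 1"
    and k: "k = (a\<^sup>2 - b\<^sup>2) / 4"
    and rc: "reaches_centre a b ((1 + descent k t) * a / 2) ((1 + descent k t) * b / 2)"
  shows "reaches_centre a b ((1 + t) * a / 2) ((1 + t) * b / 2)"
proof -
  define g where "g = descent k t"
  have k01: "0 \<le> k" "k < 1"
  proof -
    have "b\<^sup>2 \<le> a\<^sup>2" using ab by (simp add: power_mono)
    then show "0 \<le> k" unfolding k by simp
    have "0 < b\<^sup>2" using ab by simp
    then have "a\<^sup>2 - b\<^sup>2 < 4" using ab(3) by linarith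
    then show "k < 1" unfolding k by simp
  qed
  have g: "0 \<le> g" "g < 1"
    using descent_bounds[OF k01 t] t by (auto simp: g_def)
  have in_range: "r * c / 2 \<in> {0..c}" if "0 \<le> r" "r \<le> 2" "0 < c" for r c :: real
    using that by simp
  have rc1: "reaches_centre a b ((1 + g) * a / 2) ((1 - g) * b / 2)"
  proof -
    have "b - (1 + g) * b / 2 = (1 - g) * b / 2" by (simp add: field_simps)
    then show ?thesis using reaches_centre_reflect[OF rc] by (simp only: g_def)
  qed
  have "(g * a / 2 - (1 + g) * a / 2)\<^sup>2 + ((2 - g) * b / 2 - (1 - g) * b / 2)\<^sup>2 = (a\<^sup>2 + b\<^sup>2) / 4"
    by (simp add: power2_eq_square field_simps)
  then have rc2: "reaches_centre a b (g * a / 2) ((2 - g) * b / 2)"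
    using ab g by (intro reaches_centre_step[OF rc1] in_range) simp_all
  \<comment> \<open>With \<open>s = g - 1\<close> the squared distance is
    \<open>s^2 - 2 * s * t * k + t^2\<close>; \<open>descent\<close> comes from the smaller root
    \<open>s\<close> of the equation setting this to 1.\<close>
  have "((1 + t) * a / 2 - g * a / 2)\<^sup>2 + ((1 + t) * b / 2 - (2 - g) * b / 2)\<^sup>2 = 1"
  proof -
    have "t\<^sup>2 * (1 - k\<^sup>2) \<le> 1 * 1"
      using t k01 by (intro mult_mono) (auto simp: abs_square_le_1)
    then have "(1 + t * k - g)\<^sup>2 = 1 - t\<^sup>2 * (1 - k\<^sup>2)"
      by (simp add: g_def descent_def)
    moreover have "a\<^sup>2 = 2 + 2 * k" "b\<^sup>2 = 2 - 2 * k"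
      using ab k by (simp_all add: field_simps)
    moreover have "((1 + t) * a / 2 - g * a / 2)\<^sup>2 + ((1 + t) * b / 2 - (2 - g) * b / 2)\<^sup>2
       = (1 + t - g)\<^sup>2 * a\<^sup>2 / 4 + (t + g - 1)\<^sup>2 * b\<^sup>2 / 4"
      by (simp add: power2_eq_square field_simps)
    moreover have "(1 + t - g)\<^sup>2 * (2 + 2 * k) / 4 + (t + g - 1)\<^sup>2 * (2 - 2 * k) / 4
       = (1 + t * k - g)\<^sup>2 + t\<^sup>2 * (1 - k\<^sup>2)"
      by (simp add: power2_eq_square field_simps)
    ultimately show ?thesis by simp
  qed
  then show ?thesis
    using ab g t by (intro reaches_centre_step[OF rc2] in_range) simp_all
qed

text \<open>An infimum \<open>m > 0\<close> of the parameters that do not reach the centre is impossible, because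
  \<open>descent\<close> is continuous and maps \<open>m\<close> strictly below \<open>m\<close>.\<close>

lemma half_diagonal_reaches_centre:
  assumes ab: "0 < b" "b \<le> a" "a\<^sup>2 + b\<^sup>2 = (4::real)" and t: "0 \<le> t" "t \<le> 1"
  shows "reaches_centre a b ((1 + t) * a / 2) ((1 + t) * b / 2)"
proof (rule ccontr)
  let ?P = "\<lambda>t. reaches_centre a b ((1 + t) * a / 2) ((1 + t) * b / 2)"
  define k where "k = (a\<^sup>2 - b\<^sup>2) / 4"
  have k01: "0 \<le> k" "k < 1"
  proof -
    have "b\<^sup>2 \<le> a\<^sup>2" using ab by (simp add: power_mono)
    then show "0 \<le> k" unfolding k_def by simp
    have "0 < b\<^sup>2" using ab by simp
    then have "a\<^sup>2 - b\<^sup>2 < 4" using ab(3) by linarith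
    then show "k < 1" unfolding k_def by simp
  qed
  assume "\<not> ?P t"
  define B where "B = {t. 0 \<le> t \<and> t \<le> 1 \<and> \<not> ?P t}"
  define m where "m = Inf B"
  have "t \<in> B" using t \<open>\<not> ?P t\<close> by (simp add: B_def)
  have "?P 0" by (simp add: reaches_centre_def)
  have "?P 1" using corner_reaches_centre(2)[of a b] ab by (simp add: field_simps)
  have bdd: "bdd_below B" by (rule bdd_belowI[of _ 0]) (simp add: B_def)
  \<comment> \<open>This keeps \<open>B\<close> away from 0, so that \<open>m\<close> is
    positive.\<close>
  obtain d where d: "0 < d" "\<And>t. 0 < t \<Longrightarrow> t < d \<Longrightarrow> ?P t"
  proof -
    have "eventually ?P (at_right 0)"
      using ab by (intro near_centre_reaches_centre) auto
    then show ?thesis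
      using that unfolding eventually_at_right_field by blast
  qed
  have "d \<le> s" if "s \<in> B" for s
  proof (rule ccontr)
    assume "\<not> d \<le> s"
    moreover have "0 < s" using that \<open>?P 0\<close> by (auto simp: B_def less_le simp del: mult_1)
    ultimately show False using d(2)[of s] that unfolding B_def by simp
  qed
  then have "d \<le> m"
    unfolding m_def using \<open>t \<in> B\<close> by (intro cInf_greatest) auto
  moreover have "m \<le> t" unfolding m_def by (rule cInf_lower[OF \<open>t \<in> B\<close> bdd])
  moreover have "t < 1" using \<open>\<not> ?P t\<close> \<open>?P 1\<close> t by (cases "t = 1") auto
  ultimately have m: "0 < m" "m < 1" using d(1) by auto
  \<comment> \<open>The infimum \<open>m\<close> need not lie in \<open>B\<close>; continuity
    extends the strict descent below \<open>m\<close> to parameters slightly above \<open>m\<close>,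
    where \<open>B\<close> has a member if not at \<open>m\<close>.\<close>
  have "(descent k \<longlongrightarrow> descent k m) (at_right m)"
    unfolding descent_def[abs_def] by (intro tendsto_intros)
  then have "eventually (\<lambda>s. descent k s < m) (at_right m)"
    using descent_bounds(2)[OF k01 m] by (rule order_tendstoD)
  then obtain e where e: "m < e" "\<And>s. m < s \<Longrightarrow> s < e \<Longrightarrow> descent k s < m"
    unfolding eventually_at_right_field by auto
  obtain s where s: "s \<in> B" "s < e"
    using cInf_lessD[of B e] e(1) \<open>t \<in> B\<close> by (auto simp: m_def)
  have "m \<le> s" unfolding m_def by (rule cInf_lower[OF s(1) bdd])
  then have "descent k s < m"
    using e(2) s(2) descent_bounds(2)[OF k01 m] by (cases "s = m") auto
  have s01: "0 < s" "s < 1"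
    using \<open>m \<le> s\<close> m s(1) \<open>?P 1\<close> by (auto simp: B_def less_le)
  have "descent k s \<notin> B"
    using \<open>descent k s < m\<close> cInf_lower[OF _ bdd, of "descent k s"] by (auto simp: m_def)
  then have "?P (descent k s)"
    using descent_bounds[OF k01 s01] s01 by (auto simp: B_def)
  then have "?P s"
    using reaches_centre_descent[OF ab s01 k_def] by simp
  then show False using s(1) by (simp add: B_def)
qed

text \<open>\<open>s\<close> runs from corner to corner, \<open>2 * s - 1\<close> measures from the
  centre. The lower half follows by applying both reflections.\<close>

lemma diagonal_reaches_centre:
  assumes ab: "0 < b" "b \<le> a" "a\<^sup>2 + b\<^sup>2 = (4::real)" and s: "0 \<le> s" "s \<le> 1"
  shows "reaches_centre a b (s * a) (s * b)"
proof (cases "1 / 2 \<le> s")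
  case True
  have "(1 + (2 * s - 1)) * c / 2 = s * c" for c by (simp add: field_simps)
  from half_diagonal_reaches_centre[OF ab, of "2 * s - 1", unfolded this] show ?thesis
    using s True by simp
next
  case False
  have "(1 + (1 - 2 * s)) * c / 2 = c - s * c" for c by (simp add: field_simps)
  from half_diagonal_reaches_centre[OF ab, of "1 - 2 * s", unfolded this]
  have "reaches_centre a b (a - s * a) (b - s * b)"
    using s False by simp
  then have "reaches_centre a b (a - (a - s * a)) (b - (b - s * b))"
    by (rule reaches_centre_reflect[OF reaches_centre_reflect'])
  then show ?thesis by simp
qed

section \<open>Connectedness of boxes\<close>

text \<open>Positivity and order of the sides put the inner product \<open>k\<close> of the descent
  into \<open>[0, 1)\<close>.\<close>

lemma box_connected_of_section:
  fixes l :: "real ^ 'n"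
  assumes nonneg: "\<And>i. 0 \<le> l $ i" and l2: "norm l = 2"
    and sides: "0 < section_sides I l $ 2" "section_sides I l $ 2 \<le> section_sides I l $ 1"
    and xy: "x \<in> hyperrectangle l" "y \<in> hyperrectangle l"
  shows "(x, y) \<in> (unit_edges (hyperrectangle l))\<^sup>*"
proof -
  define a b where "a = section_sides I l $ 1" and "b = section_sides I l $ 2"
  have sab: "section_sides I l = vector [a, b]"
    by (simp add: a_def b_def section_sides_def)
  have ab: "0 < b" "b \<le> a" "a\<^sup>2 + b\<^sup>2 = 4"
    using sides section_sides_sum[where I = I and l = l] l2 by (simp_all add: a_def b_def)
  have to_centre: "(x, (1/2) *\<^sub>R l) \<in> (unit_edges (hyperrectangle l))\<^sup>*" if x: "x \<in> hyperrectangle l" for x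
  proof -
    obtain s where s: "s \<in> {0..1}" "(x, s *\<^sub>R l) \<in> unit_edges (hyperrectangle l)"
      using ex_diagonal_neighbour[OF nonneg l2 x] by blast
    have scale: "r *\<^sub>R section_sides I l = vector [r * a, r * b]" for r
      unfolding sab by (simp add: vec_eq_iff forall_2)
    have "(s *\<^sub>R section_sides I l, (1/2) *\<^sub>R section_sides I l)
        \<in> (unit_edges (hyperrectangle (section_sides I l)))\<^sup>*"
      using diagonal_reaches_centre[OF ab, of s] s(1)
      unfolding scale unfolding reaches_centre_def sab by simp
    then have "(section_embedding I l (s *\<^sub>R section_sides I l), section_embedding I l ((1/2) *\<^sub>R section_sides I l))
        \<in> (unit_edges (hyperrectangle l))\<^sup>*"
      by (rule unit_edges_rtrancl_image[OF _ section_embedding_in_box[OF nonneg] dist_section_embedding])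
    then have "(s *\<^sub>R l, (1/2) *\<^sub>R l) \<in> (unit_edges (hyperrectangle l))\<^sup>*"
      unfolding section_embedding_diagonal .
    with s(2) show ?thesis by (rule converse_rtrancl_into_rtrancl)
  qed
  show ?thesis
    using to_centre[OF xy(1)] unit_edges_rtrancl_sym[OF to_centre[OF xy(2)]] by (rule rtrancl_trans)
qed

lemma section_sides_Compl:
  "section_sides (- I) l $ 1 = section_sides I l $ 2" "section_sides (- I) l $ 2 = section_sides I l $ 1"
  by (simp_all add: section_sides_def)

lemma section_sides_pos:
  assumes "0 < l $ i" "i \<in> I"
  shows "0 < section_sides I l $ 1"
  using assms by (auto simp: section_sides_def intro!: sum_pos2[of I i])

text \<open>The section for \<open>{i}\<close> has two positive sides, owing to \<open>i\<close> and
  \<open>j\<close>; if the second is the longer one, passing to the complement swaps them.\<close>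

lemma box_connected_norm_eq_2:
  fixes l :: "real ^ 'n"
  assumes nonneg: "\<And>i. 0 \<le> l $ i" and l2: "norm l = 2"
    and ij: "i \<noteq> j" "0 < l $ i" "0 < l $ j"
    and xy: "x \<in> hyperrectangle l" "y \<in> hyperrectangle l"
  shows "(x, y) \<in> (unit_edges (hyperrectangle l))\<^sup>*"
proof -
  have "0 < section_sides {i} l $ 1" "0 < section_sides (- {i}) l $ 1"
    using ij by (auto intro: section_sides_pos)
  then have pos: "0 < section_sides {i} l $ 1" "0 < section_sides {i} l $ 2"
    by (simp_all only: section_sides_Compl)
  show ?thesis
  proof (cases "section_sides {i} l $ 2 \<le> section_sides {i} l $ 1")
    case True
    then show ?thesis
      by (rule box_connected_of_section[OF nonneg l2 pos(2) _ xy])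
  next
    case False
    then show ?thesis
      using pos(1) by (intro box_connected_of_section[OF nonneg l2 _ _ xy, of "- {i}"])
        (simp_all only: section_sides_Compl)
  qed
qed

text \<open>Points in a common translate of the similar box \<open>m\<close> of diagonal 2 are
  linked (\<open>near\<close>); for distant points the segment between them is cut into short pieces
  (\<open>chain\<close>).\<close>

lemma box_connected:
  fixes l :: "real ^ 'n"
  assumes nonneg: "\<And>i. 0 \<le> l $ i" and l2: "2 \<le> norm l"
    and ij: "i \<noteq> j" "0 < l $ i" "0 < l $ j"
    and xy: "x \<in> hyperrectangle l" "y \<in> hyperrectangle l"
  shows "(x, y) \<in> (unit_edges (hyperrectangle l))\<^sup>*"
proof -
  let ?X = "hyperrectangle l"
  define m where "m = (2 / norm l) *\<^sub>R l"
  have "0 < norm l" using l2 by linarith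
  then have r: "0 < 2 / norm l" "2 / norm l \<le> 1"
    using l2 by (simp_all add: divide_le_eq)
  have m0: "0 \<le> m $ i" "m $ i \<le> l $ i" for i
  proof -
    show "0 \<le> m $ i" using nonneg by (simp add: m_def)
    have "2 / norm l * l $ i \<le> l $ i"
      using mult_left_le_one_le[OF nonneg less_imp_le[OF r(1)] r(2)] .
    then show "m $ i \<le> l $ i" by (simp add: m_def)
  qed
  have conn_m: "(x, y) \<in> (unit_edges (hyperrectangle m))\<^sup>*"
    if "x \<in> hyperrectangle m" "y \<in> hyperrectangle m" for x y
    using m0(1) _ ij(1) _ _ that
    by (rule box_connected_norm_eq_2) (use l2 ij r in \<open>auto simp: m_def\<close>)
  have near: "(x, y) \<in> (unit_edges ?X)\<^sup>*"
    if "x \<in> ?X" "y \<in> ?X" and d: "\<And>i. \<bar>x $ i - y $ i\<bar> \<le> m $ i" for x y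
  proof -
    \<comment> \<open>Lower corner of a translate containing both points: their coordinatewise
      minimum, capped so that the translate stays in the box.\<close>
    define t where "t = (\<chi> i. min (min (x $ i) (y $ i)) (l $ i - m $ i))"
    have t: "0 \<le> t $ i" "t $ i \<le> l $ i - m $ i" "t $ i \<le> x $ i" "x $ i \<le> t $ i + m $ i"
        "t $ i \<le> y $ i" "y $ i \<le> t $ i + m $ i" for i
      using that(1,2) d[of i] m0[of i] by (auto simp: t_def hyperrectangle_def min_def abs_if split: if_splits; smt (verit))+
    have "(x - t, y - t) \<in> (unit_edges (hyperrectangle m))\<^sup>*"
      using t by (intro conn_m) (auto simp: hyperrectangle_def algebra_simps)
    then have "(x - t + t, y - t + t) \<in> (unit_edges ?X)\<^sup>*"
      using t by (rule_tac unit_edges_rtrancl_image[where f = "\<lambda>z. z + t"])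
        (auto simp: hyperrectangle_def dist_norm intro: add_nonneg_nonneg, smt (verit))
    then show ?thesis by simp
  qed
  have chain: "(x, y) \<in> (unit_edges ?X)\<^sup>*"
    if "x \<in> ?X" "y \<in> ?X" "\<And>i. \<bar>x $ i - y $ i\<bar> \<le> real N * m $ i" for N x y
    using that
  proof (induction N arbitrary: x)
    case 0
    then have "x = y" by (simp add: vec_eq_iff)
    then show ?case by simp
  next
    case (Suc N)
    \<comment> \<open>\<open>z\<close> will cut off the first of \<open>Suc N\<close> equal pieces
      of the segment.\<close>
    define q where "q = 1 / real (Suc N)"
    have q: "0 \<le> q" "q \<le> 1" "q * real (Suc N) = 1" by (auto simp: q_def)
    have q': "1 - q = q * real N" using q(3) by (simp add: algebra_simps)
    define z where "z = x + q *\<^sub>R (y - x)"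
    have z_conv: "z $ i = (1 - q) * x $ i + q * y $ i" for i
      by (simp add: z_def algebra_simps)
    have "z \<in> ?X"
    proof -
      have "0 \<le> z $ i \<and> z $ i \<le> l $ i" for i
        unfolding z_conv using Suc.prems(1,2) q
        by (auto simp: hyperrectangle_def intro: convex_bound_le)
      then show ?thesis by (simp add: hyperrectangle_def)
    qed
    moreover have "\<bar>x $ i - z $ i\<bar> \<le> m $ i" for i
    proof -
      have "\<bar>x $ i - z $ i\<bar> = q * \<bar>x $ i - y $ i\<bar>"
        using q(1) by (simp add: z_def abs_mult abs_minus_commute)
      also have "\<dots> \<le> q * (real (Suc N) * m $ i)"
        using Suc.prems(3) q(1) by (rule mult_left_mono)
      also have "\<dots> = m $ i" using q(3) by (simp add: mult.assoc[symmetric] del: of_nat_Suc)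
      finally show ?thesis .
    qed
    ultimately have "(x, z) \<in> (unit_edges ?X)\<^sup>*"
      using Suc.prems(1) by (intro near)
    moreover have "\<bar>z $ i - y $ i\<bar> \<le> real N * m $ i" for i
    proof -
      have "z $ i - y $ i = (1 - q) * (x $ i - y $ i)"
        by (simp add: z_conv algebra_simps)
      then have "\<bar>z $ i - y $ i\<bar> = (1 - q) * \<bar>x $ i - y $ i\<bar>"
        using q(2) by (simp add: abs_mult)
      also have "\<dots> \<le> (1 - q) * (real (Suc N) * m $ i)"
        using Suc.prems(3) q(2) by (intro mult_left_mono) auto
      also have "\<dots> = (q * real (Suc N)) * (real N * m $ i)" by (simp add: q')
      also have "\<dots> = real N * m $ i" by (simp only: q(3) mult_1)
      finally show ?thesis .
    qed
    then have "(z, y) \<in> (unit_edges ?X)\<^sup>*"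
      using \<open>z \<in> ?X\<close> Suc.prems(2) by (intro Suc.IH)
    ultimately show ?case by (rule rtrancl_trans)
  qed
  \<comment> \<open>\<open>norm l / 2\<close> is the ratio of \<open>l\<close> to
    \<open>m\<close>.\<close>
  obtain N where N: "norm l / 2 \<le> real N" using real_arch_simple by blast
  have "\<bar>x $ i - y $ i\<bar> \<le> real N * m $ i" for i
  proof -
    have "\<bar>x $ i - y $ i\<bar> \<le> l $ i"
      using xy by (auto simp: hyperrectangle_def abs_if) (smt (verit))+
    also have "\<dots> = norm l / 2 * m $ i" using l2 by (simp add: m_def)
    also have "\<dots> \<le> real N * m $ i" using N m0 by (intro mult_right_mono)
    finally show ?thesis .
  qed
  with xy show ?thesis by (rule chain)
qed

text \<open>With a single positive side the box is a segment, where linked points differ by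
  integers, so length at least 2 does not suffice; with none it is one point, connected although
  \<open>norm l = 0\<close>. Hence the premises on positive sides.\<close>

theorem proposition5p2:
  fixes l :: "real ^ 'd"
  assumes nonneg: "\<And>i. 0 \<le> l $ i"
  shows "((\<exists>i j. i \<noteq> j \<and> 0 < l $ i \<and> 0 < l $ j) \<longrightarrow>
           (Digraph_Component.connected (unit_distance_graph (hyperrectangle l)) \<longleftrightarrow> 2 \<le> norm l)) \<and>
         ((\<exists>i. 0 < l $ i) \<longrightarrow>
           (Digraph_Component.connected (unit_distance_graph (hyperrectangle l)) \<longrightarrow> 2 \<le> norm l)) \<and>
         (\<forall>I. norm l = 2 \<and> I \<noteq> {} \<and> I \<subset> UNIV \<longrightarrow>
           graph_diam (unit_distance_graph (hyperrectangle l)) \<le>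
           graph_diam (unit_distance_graph (hyperrectangle
             (vector [sqrt (\<Sum>i\<in>I. (l $ i)\<^sup>2), sqrt (\<Sum>i\<in>- I. (l $ i)\<^sup>2)] :: real ^ 2))) + 2)"
proof (intro conjI impI allI)
  have "0 \<in> hyperrectangle l"
    using nonneg by (simp add: hyperrectangle_def)
  moreover assume "\<exists>i j. i \<noteq> j \<and> 0 < l $ i \<and> 0 < l $ j"
  ultimately show "Digraph_Component.connected (unit_distance_graph (hyperrectangle l)) \<longleftrightarrow> 2 \<le> norm l"
    using box_connected[OF nonneg] connected_imp_norm_ge_2[OF nonneg]
    unfolding connected_unit_distance_graph_iff by blast
next
  assume "\<exists>i. 0 < l $ i" "Digraph_Component.connected (unit_distance_graph (hyperrectangle l))"
  then show "2 \<le> norm l"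
    using connected_imp_norm_ge_2[OF nonneg] by blast
next
  fix I :: "'d set"
  assume "norm l = 2 \<and> I \<noteq> {} \<and> I \<subset> UNIV"
  then show "graph_diam (unit_distance_graph (hyperrectangle l)) \<le>
      graph_diam (unit_distance_graph (hyperrectangle
        (vector [sqrt (\<Sum>i\<in>I. (l $ i)\<^sup>2), sqrt (\<Sum>i\<in>- I. (l $ i)\<^sup>2)] :: real ^ 2))) + 2"
    using graph_diam_le_section[OF nonneg] unfolding section_sides_def by blast
qed

end
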